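(* Let $\mathcal{G}$ be a recurrent mean-payoff bidding game with root $v_0$, let $\sigma_1,\sigma_2$ be budget strategies of the two players, and let $\mathrm{path}(c_0,\sigma_1,\sigma_2)=v^{(0)},v^{(1)},\dots$ be the path generated when the token starts at $v_0$ and Player 1's initial budget is $c_0\in[0,1]$. If $\mathtt{bif}^{\infty}$ is finite, then there exist $N_0,k\in\mathbb{N}$ with $k\ge1$ such that for every $n>N_0$ it holds that $v^{(n)}=v^{(n+k)}$.
   Context: Recurrent game: $\mathcal{G}=\langle V,E,w_1,w_2\rangle$ with $V$ finite, where $\langle V,E\rangle$ is a rooted tree with root $v_0$ (edges from parent to child) together with an edge from every leaf to $v_0$, and $w_1,w_2:V\to\mathbb{Q}$. A vine is a path from $v_0$ to a leaf; a milestone is a visit to $v_0$. Play: a configuration $\langle v,B\rangle$ means the token is on $v$, Player 1's budget is $B\in[0,1]$ and Player 2's is $1-B$. Each player submits a bid (at most its budget) and a neighbor of $v$. If the bids are $b_1,b_2$ and the chosen neighbors $u_1,u_2$, then if $b_1\ge b_2$ the next configuration is $\langle u_1,B-b_1\rangle$, otherwise it is $\langle u_2,B+b_2\rangle$. The sequence of vertices visited is the generated path. Budget strategy of Player $i$: it is given by a constant $\alpha_i\in(0,1)$, with $1-\alpha_i=(1+\alpha_i)^{-(1+\varepsilon)}$ for some $\varepsilon>0$, and fixed history-independent data: strengths $\mathrm{St}_i(v)\ge0$ (equal to $0$ at leaves), not all zero, with maximum $\mathrm{St}_{i,\max}$, and a choice $u_i(v)$ among the neighbors of $v$. At vertex $v$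 with own budget $B_i$, it bids $\xi_i(v)\cdot B_i$ where $\xi_i(v)=\alpha_i\,\mathrm{St}_i(v)/\mathrm{St}_{i,\max}$, and moves to $u_i(v)$ upon winning. Budget-update function: $\mathfrak{B}:[0,1]\to[0,1]$, where $\mathfrak{B}(c)$ is Player 1's budget at the next milestone when starting at $v_0$ with Player 1's budget $c$. It is piecewise linear (affine on each piece). Explicitly $\mathfrak{B}=\mathfrak{B}_{v_0}$, where $\mathfrak{B}_u(x)=x$ for a leaf $u$, and for an inner vertex $u$ with $\xi_i=\xi_i(u)$, $u_i=u_i(u)$: $\mathfrak{B}_u(x)=\mathfrak{B}_{u_2}((1-\xi_2)x+\xi_2)$ if $\xi_1x<\xi_2(1-x)$ and $\mathfrak{B}_u(x)=\mathfrak{B}_{u_1}((1-\xi_1)x)$ otherwise. Bifurcation points: $\mathtt{bif}\subseteq[0,1]$ is the set of points where $\mathfrak{B}$ changes from one linear branch to another; explicitly $\mathtt{bif}=\mathtt{bif}_{v_0}$, where $\mathtt{bif}_u=\emptyset$ for a leaf, and for an inner vertex $u$ with $\xi_1+\xi_2>0$ and threshold $t=\frac{\xi_2}{\xi_1+\xi_2}$, $\mathtt{bif}_u=\{t\}\cup\{x\in[0,t):(1-\xi_2)x+\xi_2\in\mathtt{bif}_{u_2}\}\cup\{x\in[t,1]:(1-\xi_1)x\in\mathtt{bif}_{u_1}\}$ (if $\xi_1=\xi_2=0$, $\mathtt{bif}_u=\mathtt{bif}_{u_1}$). Put $\mathtt{bif}^1=\mathtt{bif}$, $\mathtt{bif}^i=\mathtt{bif}^{i-1}\cup\{x\in[0,1]:\mathfrak{B}(x)\in\mathtt{bif}^{i-1}\}$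 and $\mathtt{bif}^\infty=\bigcup_{i\ge1}\mathtt{bif}^i$. *)

theory Defs
  imports Complex_Main
begin

section \<open>Recurrent bidding games\<close>

record 'v game =
  verts :: "'v set"
  edges :: "('v \<times> 'v) set"
  start :: 'v
  weight1 :: "'v \<Rightarrow> rat"
  weight2 :: "'v \<Rightarrow> rat"

definition rooted_tree :: "'v set \<Rightarrow> ('v \<times> 'v) set \<Rightarrow> 'v \<Rightarrow> bool" where
  "rooted_tree V T r \<longleftrightarrow>
     r \<in> V \<and> T \<subseteq> V \<times> V \<and> (\<forall>u. (u, r) \<notin> T) \<and>
     (\<forall>v \<in> V - {r}. \<exists>!u. (u, v) \<in> T) \<and>
     (\<forall>v \<in> V. (r, v) \<in> T\<^sup>*)"

text \<open>
  No tree edge enters the root, so the tree is recovered from the game graph by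
  discarding the edges into \<open>start\<close>.
\<close>

definition tree_edges :: "('v, 'z) game_scheme \<Rightarrow> ('v \<times> 'v) set" where
  "tree_edges G = {(u, v) \<in> edges G. v \<noteq> start G}"

definition leaf :: "('v, 'z) game_scheme \<Rightarrow> 'v \<Rightarrow> bool" where
  "leaf G u \<longleftrightarrow> u \<in> verts G \<and> (\<nexists>v. (u, v) \<in> tree_edges G)"

definition recurrent_game :: "('v, 'z) game_scheme \<Rightarrow> bool" where
  "recurrent_game G \<longleftrightarrow>
     finite (verts G) \<and>
     rooted_tree (verts G) (tree_edges G) (start G) \<and>
     edges G = tree_edges G \<union> {(l, start G) |l. leaf G l}"


section \<open>Budget strategies and plays\<close>

record 'v budget_strat =
  alpha :: real
  strength :: "'v \<Rightarrow> real"
  target :: "'v \<Rightarrow> 'v"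

definition budget_strategy :: "('v, 'z) game_scheme \<Rightarrow> 'v budget_strat \<Rightarrow> bool" where
  "budget_strategy G \<sigma> \<longleftrightarrow>
     0 < alpha \<sigma> \<and> alpha \<sigma> < 1 \<and>
     (\<exists>\<epsilon>>0. 1 - alpha \<sigma> = (1 + alpha \<sigma>) powr (- (1 + \<epsilon>))) \<and>
     (\<forall>v \<in> verts G. 0 \<le> strength \<sigma> v) \<and>
     (\<forall>v. leaf G v \<longrightarrow> strength \<sigma> v = 0) \<and>
     (\<exists>v \<in> verts G. strength \<sigma> v \<noteq> 0) \<and>
     (\<forall>v \<in> verts G. (v, target \<sigma> v) \<in> edges G)"

definition max_strength :: "('v, 'z) game_scheme \<Rightarrow> 'v budget_strat \<Rightarrow> real" where
  "max_strength G \<sigma> = Max (strength \<sigma> ` verts G)"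

definition bid_ratio :: "('v, 'z) game_scheme \<Rightarrow> 'v budget_strat \<Rightarrow> 'v \<Rightarrow> real" where
  "bid_ratio G \<sigma> v = alpha \<sigma> * strength \<sigma> v / max_strength G \<sigma>"

text \<open>A configuration is the token's vertex paired with Player 1's budget.\<close>

type_synonym 'v config = "'v \<times> real"

text \<open>An action is a bid paired with the vertex to move to.\<close>

type_synonym 'v act = "real \<times> 'v"

definition resolve_bids :: "'v act \<Rightarrow> 'v act \<Rightarrow> real \<Rightarrow> 'v config" where
  "resolve_bids a1 a2 B =
     (if fst a1 \<ge> fst a2 then (snd a1, B - fst a1) else (snd a2, B + fst a2))"

text \<open>Here \<open>b\<close> is the strategy owner's own budget.\<close>

definition budget_act ::
    "('v, 'z) game_scheme \<Rightarrow> 'v budget_strat \<Rightarrow> 'v \<Rightarrow> real \<Rightarrow> 'v act" where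
  "budget_act G \<sigma> v b = (bid_ratio G \<sigma> v * b, target \<sigma> v)"

primrec play ::
    "('v, 'z) game_scheme \<Rightarrow> 'v budget_strat \<Rightarrow> 'v budget_strat \<Rightarrow> real \<Rightarrow> nat \<Rightarrow> 'v config"
where
  "play G \<sigma>1 \<sigma>2 c 0 = (start G, c)"
| "play G \<sigma>1 \<sigma>2 c (Suc n) =
     (let (v, B) = play G \<sigma>1 \<sigma>2 c n
      in resolve_bids (budget_act G \<sigma>1 v B) (budget_act G \<sigma>2 v (1 - B)) B)"

definition gen_path ::
    "('v, 'z) game_scheme \<Rightarrow> 'v budget_strat \<Rightarrow> 'v budget_strat \<Rightarrow> real \<Rightarrow> nat \<Rightarrow> 'v" where
  "gen_path G \<sigma>1 \<sigma>2 c n = fst (play G \<sigma>1 \<sigma>2 c n)"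


section \<open>Budget updates and bifurcation points\<close>

text \<open>
  The recursion follows the tree down to a leaf; it is tail recursive, so the equation
  can be stated for arbitrary \<open>G\<close> without a termination argument.
\<close>

partial_function (tailrec) budget_update_from ::
    "('v, 'z) game_scheme \<Rightarrow> 'v budget_strat \<Rightarrow> 'v budget_strat \<Rightarrow> 'v \<Rightarrow> real \<Rightarrow> real"
where
  "budget_update_from G \<sigma>1 \<sigma>2 u x =
     (if leaf G u then x
      else if bid_ratio G \<sigma>1 u * x < bid_ratio G \<sigma>2 u * (1 - x)
      then budget_update_from G \<sigma>1 \<sigma>2 (target \<sigma>2 u)
             ((1 - bid_ratio G \<sigma>2 u) * x + bid_ratio G \<sigma>2 u)
      else budget_update_from G \<sigma>1 \<sigma>2 (target \<sigma>1 u) ((1 - bid_ratio G \<sigma>1 u) * x))"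

definition budget_update ::
    "('v, 'z) game_scheme \<Rightarrow> 'v budget_strat \<Rightarrow> 'v budget_strat \<Rightarrow> real \<Rightarrow> real" where
  "budget_update G \<sigma>1 \<sigma>2 = budget_update_from G \<sigma>1 \<sigma>2 (start G)"

definition threshold ::
    "('v, 'z) game_scheme \<Rightarrow> 'v budget_strat \<Rightarrow> 'v budget_strat \<Rightarrow> 'v \<Rightarrow> real" where
  "threshold G \<sigma>1 \<sigma>2 u =
     bid_ratio G \<sigma>2 u / (bid_ratio G \<sigma>1 u + bid_ratio G \<sigma>2 u)"

text \<open>
  Membership \<open>x \<in> bif\<^sub>u\<close>, given as a least fixed point because the recursion runs over the
  vertices of a graph; the recursive set equations are derived below.
\<close>

inductive bif_at ::
    "('v, 'z) game_scheme \<Rightarrow> 'v budget_strat \<Rightarrow> 'v budget_strat \<Rightarrow> 'v \<Rightarrow> real \<Rightarrow> bool"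
  for G \<sigma>1 \<sigma>2
where
  bif_threshold:
    "\<not> leaf G u \<Longrightarrow> bid_ratio G \<sigma>1 u + bid_ratio G \<sigma>2 u > 0 \<Longrightarrow>
     bif_at G \<sigma>1 \<sigma>2 u (threshold G \<sigma>1 \<sigma>2 u)"
| bif_below:
    "\<not> leaf G u \<Longrightarrow> bid_ratio G \<sigma>1 u + bid_ratio G \<sigma>2 u > 0 \<Longrightarrow>
     x \<in> {0..<threshold G \<sigma>1 \<sigma>2 u} \<Longrightarrow>
     bif_at G \<sigma>1 \<sigma>2 (target \<sigma>2 u) ((1 - bid_ratio G \<sigma>2 u) * x + bid_ratio G \<sigma>2 u) \<Longrightarrow>
     bif_at G \<sigma>1 \<sigma>2 u x"
| bif_above:
    "\<not> leaf G u \<Longrightarrow> bid_ratio G \<sigma>1 u + bid_ratio G \<sigma>2 u > 0 \<Longrightarrow>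
     x \<in> {threshold G \<sigma>1 \<sigma>2 u..1} \<Longrightarrow>
     bif_at G \<sigma>1 \<sigma>2 (target \<sigma>1 u) ((1 - bid_ratio G \<sigma>1 u) * x) \<Longrightarrow>
     bif_at G \<sigma>1 \<sigma>2 u x"
| bif_no_bids:
    "\<not> leaf G u \<Longrightarrow> bid_ratio G \<sigma>1 u = 0 \<Longrightarrow> bid_ratio G \<sigma>2 u = 0 \<Longrightarrow>
     bif_at G \<sigma>1 \<sigma>2 (target \<sigma>1 u) x \<Longrightarrow>
     bif_at G \<sigma>1 \<sigma>2 u x"

definition bif_from ::
    "('v, 'z) game_scheme \<Rightarrow> 'v budget_strat \<Rightarrow> 'v budget_strat \<Rightarrow> 'v \<Rightarrow> real set" where
  "bif_from G \<sigma>1 \<sigma>2 u = {x. bif_at G \<sigma>1 \<sigma>2 u x}"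

lemma bif_from_leaf:
  assumes "leaf G u"
  shows "bif_from G \<sigma>1 \<sigma>2 u = {}"
  using assms by (auto simp: bif_from_def elim: bif_at.cases)

lemma bif_from_inner:
  assumes "\<not> leaf G u" "bid_ratio G \<sigma>1 u + bid_ratio G \<sigma>2 u > 0"
  shows "bif_from G \<sigma>1 \<sigma>2 u =
    {threshold G \<sigma>1 \<sigma>2 u} \<union>
    {x \<in> {0..<threshold G \<sigma>1 \<sigma>2 u}.
       (1 - bid_ratio G \<sigma>2 u) * x + bid_ratio G \<sigma>2 u \<in> bif_from G \<sigma>1 \<sigma>2 (target \<sigma>2 u)} \<union>
    {x \<in> {threshold G \<sigma>1 \<sigma>2 u..1}.
       (1 - bid_ratio G \<sigma>1 u) * x \<in> bif_from G \<sigma>1 \<sigma>2 (target \<sigma>1 u)}"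
  (is "?L = ?R")
proof
  show "?L \<subseteq> ?R"
  proof
    fix x assume "x \<in> ?L"
    then have "bif_at G \<sigma>1 \<sigma>2 u x" by (simp add: bif_from_def)
    then show "x \<in> ?R" using assms(2) by cases (auto simp: bif_from_def)
  qed
  show "?R \<subseteq> ?L"
    using assms by (auto simp: bif_from_def intro: bif_threshold bif_below bif_above)
qed

lemma bif_from_inner_no_bids:
  assumes "\<not> leaf G u" "bid_ratio G \<sigma>1 u = 0" "bid_ratio G \<sigma>2 u = 0"
  shows "bif_from G \<sigma>1 \<sigma>2 u = bif_from G \<sigma>1 \<sigma>2 (target \<sigma>1 u)"
  using assms by (auto simp: bif_from_def elim: bif_at.cases intro: bif_no_bids)

definition bif ::
    "('v, 'z) game_scheme \<Rightarrow> 'v budget_strat \<Rightarrow> 'v budget_strat \<Rightarrow> real set" where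
  "bif G \<sigma>1 \<sigma>2 = bif_from G \<sigma>1 \<sigma>2 (start G)"

text \<open>Indexing starts at 0: \<open>bif_iter G \<sigma>1 \<sigma>2 i\<close> is \<open>bif\<close> with superscript \<open>i + 1\<close>.\<close>

primrec bif_iter ::
    "('v, 'z) game_scheme \<Rightarrow> 'v budget_strat \<Rightarrow> 'v budget_strat \<Rightarrow> nat \<Rightarrow> real set" where
  "bif_iter G \<sigma>1 \<sigma>2 0 = bif G \<sigma>1 \<sigma>2"
| "bif_iter G \<sigma>1 \<sigma>2 (Suc i) =
     bif_iter G \<sigma>1 \<sigma>2 i \<union>
     {x \<in> {0..1}. budget_update G \<sigma>1 \<sigma>2 x \<in> bif_iter G \<sigma>1 \<sigma>2 i}"

definition bif_inf ::
    "('v, 'z) game_scheme \<Rightarrow> 'v budget_strat \<Rightarrow> 'v budget_strat \<Rightarrow> real set" where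
  "bif_inf G \<sigma>1 \<sigma>2 = (\<Union>i. bif_iter G \<sigma>1 \<sigma>2 i)"

end

(* Each vertex u gets a set of critical budgets: those that are bifurcation points of u or that
   lead to a point of bif_inf at the next milestone. A single round reflects critical budgets and
   is affine away from the threshold, which is itself critical. Hence two plays standing on the
   same vertex with no critical budget between theirs visit the same vertices forever. Finitely
   many critical budgets cut [0,1] at the root into finitely many classes, and the root is visited
   infinitely often, so two milestones of the given play fall into the same class. *)
theory Submission
  imports Defs
begin

section \<open>Rooted trees have no cycles\<close>

text \<open>Induction along the path from the root. No edge enters the root; the last edge of a
  cycle through \<open>v\<close> starts at the unique parent \<open>u\<close> of \<open>v\<close>,
  so the cycle can be rotated into one through \<open>u\<close>.\<close>

lemma rooted_tree_acyclic:
  assumes "rooted_tree V T r"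
  shows "acyclic T"
proof -
  have root: "(u, r) \<notin> T" for u
    using assms by (simp add: rooted_tree_def)
  have verts: "T \<subseteq> V \<times> V" and reach: "\<forall>v \<in> V. (r, v) \<in> T\<^sup>*"
    using assms by (simp_all add: rooted_tree_def)
  have parent: "u = w" if "(u, v) \<in> T" "(w, v) \<in> T" for u v w
    using that assms unfolding rooted_tree_def by blast
  have no_cycle: "(v, v) \<notin> T\<^sup>+" if "(r, v) \<in> T\<^sup>*" for v
    using that
  proof (induction rule: rtrancl_induct)
    case base
    show ?case using root by (meson tranclE)
  next
    case (step u v)
    show ?case
    proof
      assume "(v, v) \<in> T\<^sup>+"
      then obtain w where "(v, w) \<in> T\<^sup>*" "(w, v) \<in> T"
        by (meson tranclD2)
      then have "(v, u) \<in> T\<^sup>*" using parent step.hyps(2) by blast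
      then have "(u, u) \<in> T\<^sup>+" using step.hyps(2) by (meson rtrancl_into_trancl2)
      then show False using step.IH by blast
    qed
  qed
  show ?thesis
    unfolding acyclic_def
  proof (intro allI notI)
    fix v assume cyc: "(v, v) \<in> T\<^sup>+"
    then have "v \<in> V" using verts by (meson mem_Sigma_iff subsetD tranclD)
    then show False using no_cycle reach cyc by blast
  qed
qed

section \<open>Points with no cut between them\<close>

text \<open>An equivalence whose classes are the single points of \<open>Q\<close> and the gaps
  between them. The interval is closed so that a point of \<open>Q\<close> is never grouped with its
  neighbors; the case \<open>x = y\<close> keeps the relation reflexive on \<open>Q\<close>.\<close>

definition unseparated :: "'a::linorder set \<Rightarrow> 'a \<Rightarrow> 'a \<Rightarrow> bool" where
  "unseparated Q x y \<longleftrightarrow> x = y \<or> {min x y..max x y} \<inter> Q = {}"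

lemma unseparated_refl: "unseparated Q x x"
  by (simp add: unseparated_def)

lemma unseparated_commute: "unseparated Q x y \<longleftrightarrow> unseparated Q y x"
  by (auto simp: unseparated_def min.commute max.commute)

lemma unseparated_le_iff:
  "x < y \<Longrightarrow> unseparated Q x y \<longleftrightarrow> (\<forall>q. x \<le> q \<and> q \<le> y \<longrightarrow> q \<notin> Q)"
  by (auto simp: unseparated_def)

lemma unseparated_mono: "unseparated Q x y \<Longrightarrow> Q' \<subseteq> Q \<Longrightarrow> unseparated Q' x y"
  by (auto simp: unseparated_def)

text \<open>For \<open>x < y\<close>, a point of \<open>Q\<close> in between would be
  \<open>\<le> x\<close> or \<open>< x\<close> according to the second or first assumption, which is
  absurd. A finite \<open>Q\<close> admits only finitely many such pairs of sets, which prepares a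
  pigeonhole argument.\<close>

lemma unseparated_if_same_cuts:
  assumes "{q \<in> Q. q < x} = {q \<in> Q. q < y}" "{q \<in> Q. q \<le> x} = {q \<in> Q. q \<le> y}"
  shows "unseparated Q x y"
  using assms
proof (induction x y rule: linorder_less_wlog)
  case (less x y)
  have "q \<notin> Q" if "x \<le> q" "q \<le> y" for q
  proof
    assume "q \<in> Q"
    with less.prems(2) \<open>q \<le> y\<close> have "q \<le> x" by blast
    then have "q < y" using less.hyps by simp
    with less.prems(1) \<open>q \<in> Q\<close> have "q < x" by blast
    then show False using \<open>x \<le> q\<close> by simp
  qed
  with less.hyps show ?case by (simp add: unseparated_le_iff)
next
  case (refl x)
  show ?case by (rule unseparated_refl)
next
  case (sym x y)
  show ?case using sym.IH[OF sym.prems(1)[symmetric] sym.prems(2)[symmetric]]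
    by (simp add: unseparated_commute)
qed

text \<open>A point of \<open>Q'\<close> between the images pulls back along the increasing map to a
  point of \<open>Q\<close> between \<open>x\<close> and \<open>y\<close>. Reflection is asked only
  on that interval, since a round of play is affine only locally.\<close>

lemma unseparated_affine:
  fixes m c x y :: real
  assumes "unseparated Q x y" "m > 0"
    and "\<And>z. min x y \<le> z \<Longrightarrow> z \<le> max x y \<Longrightarrow> m * z + c \<in> Q' \<Longrightarrow> z \<in> Q"
  shows "unseparated Q' (m * x + c) (m * y + c)"
  using assms(1,3)
proof (induction x y rule: linorder_less_wlog)
  case (less x y)
  have "q \<notin> Q'" if "m * x + c \<le> q" "q \<le> m * y + c" for q
  proof
    assume q: "q \<in> Q'"
    define z where "z = (q - c) / m"
    have "m * z + c = q" "x \<le> z" "z \<le> y"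
      using that \<open>m > 0\<close> by (simp_all add: z_def field_simps)
    then show False
      using less q by (auto simp: unseparated_le_iff)
  qed
  then show ?case using less.hyps \<open>m > 0\<close> by (simp add: unseparated_le_iff)
next
  case (refl x)
  show ?case by (rule unseparated_refl)
next
  case (sym x y)
  have "unseparated Q' (m * y + c) (m * x + c)"
  proof (rule sym.IH)
    show "unseparated Q y x" using sym.prems(1) by (simp add: unseparated_commute)
    show "z \<in> Q" if "min y x \<le> z" "z \<le> max y x" "m * z + c \<in> Q'" for z
      using that sym.prems(2) by (simp add: min.commute max.commute)
  qed
  then show ?case by (simp add: unseparated_commute)
qed

section \<open>Bid ratios and the game graph\<close>

locale budget_play =
  fixes G :: "'v game" and \<sigma>1 \<sigma>2 :: "'v budget_strat"
  assumes game: "recurrent_game G"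
    and strat1: "budget_strategy G \<sigma>1"
    and strat2: "budget_strategy G \<sigma>2"
begin

abbreviation "\<xi>1 \<equiv> bid_ratio G \<sigma>1"
abbreviation "\<xi>2 \<equiv> bid_ratio G \<sigma>2"

text \<open>A nonzero strength makes the maximum positive, and \<open>alpha \<sigma> < 1\<close>
  makes the upper bound strict. Strictness gives each branch of a round a positive slope.\<close>

lemma bid_ratio_bounds:
  assumes "budget_strategy G \<sigma>" "u \<in> verts G"
  shows "0 \<le> bid_ratio G \<sigma> u" "bid_ratio G \<sigma> u < 1"
proof -
  have fin: "finite (verts G)" using game by (simp add: recurrent_game_def)
  obtain v where v: "v \<in> verts G" "strength \<sigma> v > 0"
    using assms(1) unfolding budget_strategy_def by force
  have le: "strength \<sigma> w \<le> max_strength G \<sigma>" if "w \<in> verts G" for w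
    using that fin by (simp add: max_strength_def)
  have pos: "max_strength G \<sigma> > 0" using le[OF v(1)] v(2) by simp
  have s: "0 \<le> strength \<sigma> u" and a: "0 < alpha \<sigma>" "alpha \<sigma> < 1"
    using assms by (auto simp: budget_strategy_def)
  show "0 \<le> bid_ratio G \<sigma> u" using pos s a by (simp add: bid_ratio_def)
  have "alpha \<sigma> * strength \<sigma> u \<le> alpha \<sigma> * max_strength G \<sigma>"
    using le[OF assms(2)] a by simp
  also have "\<dots> < max_strength G \<sigma>" using pos a by simp
  finally show "bid_ratio G \<sigma> u < 1" using pos by (simp add: bid_ratio_def)
qed

lemmas \<xi>1_bounds = bid_ratio_bounds[OF strat1]
lemmas \<xi>2_bounds = bid_ratio_bounds[OF strat2]

lemma leaf_bids:
  assumes "leaf G u"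
  shows "\<xi>1 u = 0" "\<xi>2 u = 0"
  using assms strat1 strat2 by (auto simp: budget_strategy_def bid_ratio_def)

lemma target_edge:
  assumes "u \<in> verts G"
  shows "(u, target \<sigma>1 u) \<in> edges G" "(u, target \<sigma>2 u) \<in> edges G"
  using assms strat1 strat2 by (auto simp: budget_strategy_def)

lemma edge_verts:
  assumes "(u, v) \<in> edges G"
  shows "v \<in> verts G"
proof -
  have "edges G = tree_edges G \<union> {(l, start G) |l. leaf G l}"
    "tree_edges G \<subseteq> verts G \<times> verts G" "start G \<in> verts G"
    using game by (simp_all add: recurrent_game_def rooted_tree_def)
  then show ?thesis using assms by blast
qed

lemma leaf_target: "leaf G u \<Longrightarrow> target \<sigma>1 u = start G"
  using target_edge(1)[of u] by (auto simp: leaf_def tree_edges_def)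

lemma wf_tree_edges: "wf ((tree_edges G)\<inverse>)"
proof -
  have "finite (verts G)" and tree: "rooted_tree (verts G) (tree_edges G) (start G)"
    using game by (simp_all add: recurrent_game_def)
  moreover have "tree_edges G \<subseteq> verts G \<times> verts G"
    using tree by (simp add: rooted_tree_def)
  ultimately have "finite (tree_edges G)" by (meson finite_SigmaI finite_subset)
  then show ?thesis using rooted_tree_acyclic[OF tree] by (rule finite_acyclic_wf_converse)
qed

section \<open>One round of play\<close>

text \<open>The test and branches are arranged as in \<open>budget_update_from\<close>, so that one
  round corresponds to one unfolding of that recursion.\<close>

definition play_step :: "'v config \<Rightarrow> 'v config" where
  "play_step c = (case c of (u, x) \<Rightarrow>
     if \<xi>1 u * x < \<xi>2 u * (1 - x) then (target \<sigma>2 u, (1 - \<xi>2 u) * x + \<xi>2 u)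
     else (target \<sigma>1 u, (1 - \<xi>1 u) * x))"

lemma play_Suc: "play G \<sigma>1 \<sigma>2 c (Suc n) = play_step (play G \<sigma>1 \<sigma>2 c n)"
proof -
  obtain u x where "play G \<sigma>1 \<sigma>2 c n = (u, x)" by force
  then show ?thesis
    by (simp add: play_step_def resolve_bids_def budget_act_def left_diff_distrib right_diff_distrib)
qed

lemma play_step_edge: "u \<in> verts G \<Longrightarrow> (u, fst (play_step (u, x))) \<in> edges G"
  using target_edge by (simp add: play_step_def)

lemma play_step_range:
  assumes "u \<in> verts G" "x \<in> {0..1}"
  shows "snd (play_step (u, x)) \<in> {0..1}"
proof -
  \<comment> \<open>Seen from Player 2, a win scales the own budget \<open>1 - x\<close> by
    \<open>1 - \<xi>2 u\<close>.\<close>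
  have "(1 - \<xi>2 u) * x + \<xi>2 u = 1 - (1 - \<xi>2 u) * (1 - x)" by (simp add: algebra_simps)
  then show ?thesis
    using assms \<xi>1_bounds[OF assms(1)] \<xi>2_bounds[OF assms(1)]
    by (auto simp: play_step_def mult_le_one)
qed

lemma play_range:
  assumes "c \<in> {0..1}"
  shows "fst (play G \<sigma>1 \<sigma>2 c n) \<in> verts G \<and> snd (play G \<sigma>1 \<sigma>2 c n) \<in> {0..1}"
proof (induction n)
  case 0
  show ?case using assms game by (simp add: recurrent_game_def rooted_tree_def)
next
  case (Suc n)
  obtain u x where ux: "play G \<sigma>1 \<sigma>2 c n = (u, x)" by force
  show ?case
    using Suc edge_verts[OF play_step_edge, of u x] play_step_range[of u x]
    unfolding play_Suc ux by simp
qed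

lemma below_threshold_iff:
  assumes "\<xi>1 u + \<xi>2 u > 0"
  shows "\<xi>1 u * x < \<xi>2 u * (1 - x) \<longleftrightarrow> x < threshold G \<sigma>1 \<sigma>2 u"
  using assms by (simp add: threshold_def pos_less_divide_eq algebra_simps)

lemma threshold_range:
  assumes "u \<in> verts G" "\<xi>1 u + \<xi>2 u > 0"
  shows "threshold G \<sigma>1 \<sigma>2 u \<in> {0..1}"
  using assms \<xi>1_bounds[OF assms(1)] \<xi>2_bounds[OF assms(1)]
  by (simp add: threshold_def pos_divide_le_eq)

section \<open>Critical budgets and their pullback along a round\<close>

definition critical :: "'v \<Rightarrow> real set" where
  "critical u = {x \<in> {0..1}.
     bif_at G \<sigma>1 \<sigma>2 u x \<or> budget_update_from G \<sigma>1 \<sigma>2 u x \<in> bif_inf G \<sigma>1 \<sigma>2}"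

text \<open>This closes the loop from a leaf back to the root: a budget whose update lies in level
  \<open>i\<close> of \<open>bif_iter\<close> lies itself in level \<open>Suc i\<close>.\<close>

lemma critical_start_subset: "critical (start G) \<subseteq> bif_inf G \<sigma>1 \<sigma>2"
proof
  fix x assume "x \<in> critical (start G)"
  then consider "bif_at G \<sigma>1 \<sigma>2 (start G) x"
    | i where "x \<in> {0..1}" "budget_update G \<sigma>1 \<sigma>2 x \<in> bif_iter G \<sigma>1 \<sigma>2 i"
    by (auto simp: critical_def bif_inf_def budget_update_def)
  then show "x \<in> bif_inf G \<sigma>1 \<sigma>2"
  proof cases
    case 1
    then have "x \<in> bif_iter G \<sigma>1 \<sigma>2 0" by (simp add: bif_def bif_from_def)
    then show ?thesis unfolding bif_inf_def by blast
  next
    case 2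
    then have "x \<in> bif_iter G \<sigma>1 \<sigma>2 (Suc i)" by simp
    then show ?thesis unfolding bif_inf_def by blast
  qed
qed

lemma threshold_critical:
  assumes "u \<in> verts G" "\<xi>1 u + \<xi>2 u > 0"
  shows "threshold G \<sigma>1 \<sigma>2 u \<in> critical u"
proof -
  have "\<not> leaf G u" using assms(2) leaf_bids[of u] by auto
  then show ?thesis
    using threshold_range assms bif_threshold by (auto simp: critical_def)
qed

text \<open>At a leaf the budget is unchanged and the root's critical budgets lie in
  \<open>bif_inf\<close>, which is the second disjunct of \<open>critical\<close>. At an inner
  vertex the round preserves the budget at the next milestone, and the introduction rule of
  \<open>bif_at\<close> for the branch taken pulls bifurcation points back.\<close>

lemma play_step_reflects_critical:
  assumes u: "u \<in> verts G" and x: "x \<in> {0..1}"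
    and crit: "snd (play_step (u, x)) \<in> critical (fst (play_step (u, x)))"
  shows "x \<in> critical u"
proof (cases "leaf G u")
  case True
  then have "play_step (u, x) = (start G, x)"
    using leaf_bids leaf_target by (simp add: play_step_def)
  then have "x \<in> bif_inf G \<sigma>1 \<sigma>2" using crit critical_start_subset by auto
  then show ?thesis
    using True x by (simp add: critical_def budget_update_from.simps[of G \<sigma>1 \<sigma>2 u])
next
  case inner: False
  obtain v y where vy: "play_step (u, x) = (v, y)" by force
  have upd: "budget_update_from G \<sigma>1 \<sigma>2 u x = budget_update_from G \<sigma>1 \<sigma>2 v y"
    using inner vy by (auto simp: play_step_def budget_update_from.simps[of G \<sigma>1 \<sigma>2 u]
        split: if_splits)
  have "bif_at G \<sigma>1 \<sigma>2 u x" if bif: "bif_at G \<sigma>1 \<sigma>2 v y"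
  proof (cases "\<xi>1 u + \<xi>2 u > 0")
    case True
    show ?thesis
    proof (cases "x < threshold G \<sigma>1 \<sigma>2 u")
      case below: True
      have "v = target \<sigma>2 u" "y = (1 - \<xi>2 u) * x + \<xi>2 u"
        using vy below below_threshold_iff[OF True] by (auto simp: play_step_def)
      then show ?thesis using bif_below[OF inner True] below x bif by simp
    next
      case above: False
      have "v = target \<sigma>1 u" "y = (1 - \<xi>1 u) * x"
        using vy above below_threshold_iff[OF True] by (auto simp: play_step_def)
      then show ?thesis using bif_above[OF inner True] above x bif by simp
    qed
  next
    case False
    then have zero: "\<xi>1 u = 0" "\<xi>2 u = 0"
      using \<xi>1_bounds[OF u] \<xi>2_bounds[OF u] by auto
    then have "v = target \<sigma>1 u" "y = x" using vy by (auto simp: play_step_def)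
    then show ?thesis using bif_no_bids[OF inner zero] bif by simp
  qed
  then show ?thesis using crit upd x vy by (auto simp: critical_def)
qed

section \<open>Unseparated plays stay together\<close>

text \<open>The threshold is critical, so it cannot lie between distinct unseparated budgets; if
  both ratios vanish, Player 1 wins every tie. Stating this for every \<open>z\<close> in between
  puts the whole interval on one affine branch.\<close>

lemma same_winner:
  assumes u: "u \<in> verts G" and unsep: "unseparated (critical u) x y"
    and z: "min x y \<le> z" "z \<le> max x y"
  shows "\<xi>1 u * z < \<xi>2 u * (1 - z) \<longleftrightarrow> \<xi>1 u * x < \<xi>2 u * (1 - x)"
proof (cases "\<xi>1 u + \<xi>2 u > 0")
  case True
  let ?t = "threshold G \<sigma>1 \<sigma>2 u"
  have "x = y \<or> \<not> (min x y \<le> ?t \<and> ?t \<le> max x y)"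
    using unsep threshold_critical[OF u True] by (auto simp: unseparated_def)
  then have "z < ?t \<longleftrightarrow> x < ?t" using z by linarith
  then show ?thesis using below_threshold_iff[OF True] by simp
next
  case False
  then have "\<xi>1 u = 0" "\<xi>2 u = 0" using \<xi>1_bounds[OF u] \<xi>2_bounds[OF u] by auto
  then show ?thesis by simp
qed

lemma play_step_unseparated:
  assumes u: "u \<in> verts G" and x: "x \<in> {0..1}" and y: "y \<in> {0..1}"
    and unsep: "unseparated (critical u) x y"
  obtains v x' y' where "play_step (u, x) = (v, x')" "play_step (u, y) = (v, y')"
    "unseparated (critical v) x' y'"
proof -
  obtain v m c where "m > 0" and
    affine: "\<And>z. min x y \<le> z \<Longrightarrow> z \<le> max x y \<Longrightarrow> play_step (u, z) = (v, m * z + c)"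
  proof (cases "\<xi>1 u * x < \<xi>2 u * (1 - x)")
    case True
    then have "play_step (u, z) = (target \<sigma>2 u, (1 - \<xi>2 u) * z + \<xi>2 u)"
      if "min x y \<le> z" "z \<le> max x y" for z
      unfolding play_step_def using same_winner[OF u unsep that] by simp
    then show thesis using that[of "1 - \<xi>2 u"] \<xi>2_bounds(2)[OF u] by simp
  next
    case False
    then have "play_step (u, z) = (target \<sigma>1 u, (1 - \<xi>1 u) * z + 0)"
      if "min x y \<le> z" "z \<le> max x y" for z
      unfolding play_step_def using same_winner[OF u unsep that] by simp
    then show thesis using that[of "1 - \<xi>1 u" "target \<sigma>1 u" 0] \<xi>1_bounds(2)[OF u] by simp
  qed
  have "unseparated (critical v) (m * x + c) (m * y + c)"
    using unsep \<open>m > 0\<close>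
  proof (rule unseparated_affine)
    fix z assume z: "min x y \<le> z" "z \<le> max x y" "m * z + c \<in> critical v"
    then have "z \<in> {0..1}" using x y by auto
    then show "z \<in> critical u"
      using play_step_reflects_critical[OF u] affine[OF z(1,2)] z(3) by simp
  qed
  then show thesis using that affine[of x] affine[of y] by simp
qed

lemma play_unseparated:
  assumes c: "c \<in> {0..1}" and same: "gen_path G \<sigma>1 \<sigma>2 c i = gen_path G \<sigma>1 \<sigma>2 c j"
    and unsep: "unseparated (critical (gen_path G \<sigma>1 \<sigma>2 c i))
       (snd (play G \<sigma>1 \<sigma>2 c i)) (snd (play G \<sigma>1 \<sigma>2 c j))"
  shows "gen_path G \<sigma>1 \<sigma>2 c (i + n) = gen_path G \<sigma>1 \<sigma>2 c (j + n)"
proof -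
  \<comment> \<open>The induction must also carry that the budgets remain unseparated at the common
    vertex.\<close>
  have "gen_path G \<sigma>1 \<sigma>2 c (i + n) = gen_path G \<sigma>1 \<sigma>2 c (j + n) \<and>
    unseparated (critical (gen_path G \<sigma>1 \<sigma>2 c (i + n)))
       (snd (play G \<sigma>1 \<sigma>2 c (i + n))) (snd (play G \<sigma>1 \<sigma>2 c (j + n)))"
  proof (induction n)
    case 0
    show ?case using same unsep by simp
  next
    case (Suc n)
    obtain u x y where ux: "play G \<sigma>1 \<sigma>2 c (i + n) = (u, x)"
      and uy: "play G \<sigma>1 \<sigma>2 c (j + n) = (u, y)" and uns: "unseparated (critical u) x y"
      using Suc by (metis gen_path_def prod.collapse)
    have "u \<in> verts G" "x \<in> {0..1}" "y \<in> {0..1}"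
      using play_range[OF c, of "i + n"] play_range[OF c, of "j + n"] ux uy by auto
    then obtain v x' y' where "play_step (u, x) = (v, x')" "play_step (u, y) = (v, y')"
      "unseparated (critical v) x' y'"
      using play_step_unseparated uns by blast
    then show ?case
      using ux uy by (simp add: gen_path_def play_Suc del: play.simps)
  qed
  then show ?thesis ..
qed

text \<open>After a last milestone every move would follow a tree edge, giving an infinite descent
  in a finite tree.\<close>

lemma infinitely_many_milestones:
  assumes "c \<in> {0..1}"
  shows "infinite {n. gen_path G \<sigma>1 \<sigma>2 c n = start G}"
proof
  assume "finite {n. gen_path G \<sigma>1 \<sigma>2 c n = start G}"
  then obtain N where N: "\<And>n. gen_path G \<sigma>1 \<sigma>2 c n = start G \<Longrightarrow> n < N"
    unfolding finite_nat_set_iff_bounded by blast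
  let ?v = "\<lambda>i. gen_path G \<sigma>1 \<sigma>2 c (N + i)"
  have "(?v (Suc i), ?v i) \<in> (tree_edges G)\<inverse>" for i
  proof -
    have "(gen_path G \<sigma>1 \<sigma>2 c (N + i), gen_path G \<sigma>1 \<sigma>2 c (N + Suc i)) \<in> edges G"
      using play_step_edge play_range[OF assms, of "N + i"]
      by (simp add: gen_path_def play_Suc del: play.simps) (metis prod.collapse)
    moreover have "gen_path G \<sigma>1 \<sigma>2 c (N + Suc i) \<noteq> start G"
      using N[of "N + Suc i"] by auto
    ultimately show ?thesis by (simp add: tree_edges_def)
  qed
  then have "\<exists>f. \<forall>i. (f (Suc i), f i) \<in> (tree_edges G)\<inverse>" by (intro exI[of _ ?v]) blast
  then show False
    using wf_tree_edges by (simp add: wf_iff_no_infinite_down_chain)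
qed

end

section \<open>Pigeonhole over the milestones\<close>

theorem theorem14:
  fixes G :: "'v game" and \<sigma>1 \<sigma>2 :: "'v budget_strat" and c0 :: real
  assumes "recurrent_game G"
    and "budget_strategy G \<sigma>1"
    and "budget_strategy G \<sigma>2"
    and "c0 \<in> {0..1}"
    and "finite (bif_inf G \<sigma>1 \<sigma>2)"
  shows "\<exists>N0 k :: nat. k \<ge> 1 \<and>
    (\<forall>n > N0. gen_path G \<sigma>1 \<sigma>2 c0 n = gen_path G \<sigma>1 \<sigma>2 c0 (n + k))"
proof -
  interpret budget_play G \<sigma>1 \<sigma>2 using assms(1-3) by unfold_locales
  let ?P = "bif_inf G \<sigma>1 \<sigma>2"
  let ?M = "{n. gen_path G \<sigma>1 \<sigma>2 c0 n = start G}"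
  let ?b = "\<lambda>n. snd (play G \<sigma>1 \<sigma>2 c0 n)"
  \<comment> \<open>Both the strict and the weak cut are recorded: together they tell a point of
    \<open>bif_inf\<close> from the gaps on either side of it.\<close>
  define cuts where "cuts n = ({q \<in> ?P. q < ?b n}, {q \<in> ?P. q \<le> ?b n})" for n
  have "cuts ` ?M \<subseteq> Pow ?P \<times> Pow ?P" by (auto simp: cuts_def)
  then have "finite (cuts ` ?M)" using assms(5) by (meson finite_Pow_iff finite_SigmaI finite_subset)
  then have "\<not> inj_on cuts ?M"
    using infinitely_many_milestones[OF assms(4)] finite_imageD by blast
  then obtain i j where ij: "i < j" "i \<in> ?M" "j \<in> ?M" "cuts i = cuts j"
    unfolding inj_on_def by (metis nat_neq_iff)
  have "unseparated ?P (?b i) (?b j)"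
    using ij(4) by (intro unseparated_if_same_cuts) (simp_all add: cuts_def)
  then have unsep: "unseparated (critical (start G)) (?b i) (?b j)"
    using critical_start_subset by (rule unseparated_mono)
  have shift: "gen_path G \<sigma>1 \<sigma>2 c0 (i + m) = gen_path G \<sigma>1 \<sigma>2 c0 (j + m)" for m
    using play_unseparated[OF assms(4), of i j m] unsep ij(2,3) by simp
  \<comment> \<open>The witnesses are \<open>N0 = i\<close> and the period
    \<open>k = j - i\<close>.\<close>
  have "gen_path G \<sigma>1 \<sigma>2 c0 n = gen_path G \<sigma>1 \<sigma>2 c0 (n + (j - i))" if "n > i" for n
    using shift[of "n - i"] that ij(1) by (simp add: add.commute)
  moreover have "j - i \<ge> 1" using ij(1) by simp
  ultimately show ?thesis by blast
qed

end
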